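(* For $n\ge 0$ let $b_{n}$ be the number of words $w=w_1\cdots w_n\in\{1,2,3,4,5\}^n$ in which each letter differs from at least one of its neighbors by $1$ or less. Then $$\sum_{n\ge 0}b_nt^n=\frac{1-3t+9t^2-4t^3+6t^4+4t^6}{1-3t-4t^2-6t^4-4t^5-4t^6},$$ and consequently $$b_n=3b_{n-1}+4b_{n-2}+6b_{n-4}+4b_{n-5}+4b_{n-6}\qquad\text{for } n>6 .$$
   Context: The neighbors of the letter $w_i$ in $w=w_1\cdots w_n$ are $w_{i-1}$ (if $i\ge 2$) and $w_{i+1}$ (if $i\le n-1$). So $b_n$ counts words such that for every $i$, $|w_i-w_{i-1}|\le 1$ or $|w_i-w_{i+1}|\le 1$ for some existing neighbor; the empty word counts, so $b_0=1$, and a one-letter word has no neighbors, so $b_1=0$. *)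

theory Defs
  imports "HOL-Computational_Algebra.Formal_Power_Series"
begin

(* Positions are 0-based: the letter w_i of the informal text is w ! (i - 1). *)
definition neighbors :: "int list \<Rightarrow> nat \<Rightarrow> nat set" where
  "neighbors w i = {j. j < length w \<and> (j = i + 1 \<or> i = j + 1)}"

definition good_word :: "int list \<Rightarrow> bool" where
  "good_word w \<longleftrightarrow> (\<forall>i < length w. \<exists>j \<in> neighbors w i. \<bar>w ! i - w ! j\<bar> \<le> 1)"

definition b :: "nat \<Rightarrow> nat" where
  "b n = card {w :: int list. length w = n \<and> set w \<subseteq> {1..5} \<and> good_word w}"

end

theory Submission
  imports Defs
begin

text \<open>Read a word from left to right, remembering the last letter \<open>a\<close> and whether \<open>a\<close> already has
  a close neighbour. The completions of such a state are counted by a linear system in ten unknowns;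
  the reflection \<open>a \<mapsto> 6 - a\<close> reduces it to six, and the denominator of the generating function is
  the reciprocal characteristic polynomial of the reduced system.\<close>

text \<open>If \<open>c\<close> is far from \<open>a\<close>, the last chance of \<open>a\<close> is
  gone: \<open>s\<close> must already hold, and \<open>c\<close> starts without a close
  neighbour.\<close>

primrec completes :: "bool \<Rightarrow> int \<Rightarrow> int list \<Rightarrow> bool" where
  "completes s a [] = s"
| "completes s a (c # w) = (if \<bar>a - c\<bar> \<le> 1 then completes True c w else s \<and> completes False c w)"

lemma close_neighbor_Cons_0:
  "(\<exists>j \<in> neighbors (a # c # w) 0. \<bar>(a # c # w) ! 0 - (a # c # w) ! j\<bar> \<le> 1) \<longleftrightarrow> \<bar>a - c\<bar> \<le> 1"
  by (auto simp: neighbors_def)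

text \<open>Prepending \<open>a\<close> shifts all positions by one and gives a new neighbour only
  to \<open>c\<close>, the former head.\<close>

lemma close_neighbor_Cons_Suc:
  "(\<exists>j \<in> neighbors (a # c # w) (Suc i). \<bar>(a # c # w) ! Suc i - (a # c # w) ! j\<bar> \<le> 1) \<longleftrightarrow>
   (i = 0 \<and> \<bar>a - c\<bar> \<le> 1) \<or> (\<exists>j \<in> neighbors (c # w) i. \<bar>(c # w) ! i - (c # w) ! j\<bar> \<le> 1)"
    (is "?L \<longleftrightarrow> ?R")
proof
  assume ?L
  then obtain j where j: "j \<in> neighbors (a # c # w) (Suc i)"
    "\<bar>(a # c # w) ! Suc i - (a # c # w) ! j\<bar> \<le> 1" by blast
  show ?R
  proof (cases j)
    case 0
    with j show ?thesis by (auto simp: neighbors_def abs_minus_commute)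
  next
    case (Suc k)
    with j have "k \<in> neighbors (c # w) i" by (auto simp: neighbors_def)
    with j Suc show ?thesis by auto
  qed
next
  assume ?R
  then consider "i = 0" "\<bar>a - c\<bar> \<le> 1"
    | j where "j \<in> neighbors (c # w) i" "\<bar>(c # w) ! i - (c # w) ! j\<bar> \<le> 1" by blast
  then show ?L
  proof cases
    case 1
    then show ?thesis by (intro bexI[of _ 0]) (auto simp: neighbors_def)
  next
    case 2
    then show ?thesis by (intro bexI[of _ "Suc j"]) (auto simp: neighbors_def)
  qed
qed

text \<open>Links the left-to-right reading to \<open>good_word\<close>: the flag \<open>s\<close>
  excuses position 0 and no other.\<close>

lemma completes_iff:
  "completes s a w \<longleftrightarrow> (\<forall>i < length (a # w). (i = 0 \<and> s) \<or>
     (\<exists>j \<in> neighbors (a # w) i. \<bar>(a # w) ! i - (a # w) ! j\<bar> \<le> 1))"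
proof (induction w arbitrary: s a)
  case Nil
  then show ?case by (auto simp: neighbors_def)
next
  case (Cons c w)
  \<comment> \<open>Closeness of \<open>a\<close> and \<open>c\<close> acts twice: it settles
    position 0, and it is the flag of \<open>c\<close> in the induction hypothesis.\<close>
  have "(\<forall>i < length (a # c # w). (i = 0 \<and> s) \<or>
      (\<exists>j \<in> neighbors (a # c # w) i. \<bar>(a # c # w) ! i - (a # c # w) ! j\<bar> \<le> 1)) \<longleftrightarrow>
    (s \<or> \<bar>a - c\<bar> \<le> 1) \<and> completes (\<bar>a - c\<bar> \<le> 1) c w"
    unfolding length_Cons[of a] All_less_Suc2 close_neighbor_Cons_0 close_neighbor_Cons_Suc Cons.IH
    by simp
  then show ?case by auto
qed

lemma good_word_Cons: "good_word (a # w) \<longleftrightarrow> completes False a w"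
  by (simp only: good_word_def completes_iff) simp

definition words :: "'a set \<Rightarrow> nat \<Rightarrow> 'a list set" where
  "words A n = {w. length w = n \<and> set w \<subseteq> A}"

lemma card_words_Suc:
  assumes "finite A"
  shows "card {w \<in> words A (Suc n). P w} = (\<Sum>c\<in>A. card {w \<in> words A n. P (c # w)})"
proof -
  have fin: "finite (words A n)"
    using finite_lists_length_eq[OF assms, of n] by (simp add: words_def conj_commute)
  have eq: "{w \<in> words A (Suc n). P w} = (\<Union>c\<in>A. (#) c ` {w \<in> words A n. P (c # w)})"
    by (auto simp: words_def length_Suc_conv)
  show ?thesis
    unfolding eq using assms fin
    by (subst card_UN_disjoint) (auto simp: card_image)
qed

definition completions :: "nat \<Rightarrow> bool \<Rightarrow> int \<Rightarrow> nat" where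
  "completions n s a = card {w \<in> words {1..5} n. completes s a w}"

lemma completions_0: "completions 0 s a = (if s then 1 else 0)"
proof -
  have "{w \<in> words {1..5} 0. completes s a w} = (if s then {[]} else {})"
    by (auto simp: words_def)
  then show ?thesis by (simp add: completions_def)
qed

lemma completions_Suc:
  "completions (Suc n) s a = (\<Sum>c\<in>{1..5}. if \<bar>a - c\<bar> \<le> 1 then completions n True c
     else if s then completions n False c else 0)"
  unfolding completions_def by (subst card_words_Suc) (auto intro!: sum.cong)

lemma b_0: "b 0 = 1"
proof -
  have "{w :: int list. length w = 0 \<and> set w \<subseteq> {1..5} \<and> good_word w} = {[]}"
    by (auto simp: good_word_def)
  then show ?thesis by (simp add: b_def)
qed

lemma b_Suc: "b (Suc n) = (\<Sum>a\<in>{1..5}. completions n False a)"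
proof -
  have "b (Suc n) = card {w \<in> words {1..5} (Suc n). good_word w}"
    by (simp add: b_def words_def)
  also have "\<dots> = (\<Sum>a\<in>{1..5}. completions n False a)"
    by (subst card_words_Suc) (simp_all add: good_word_Cons completions_def)
  finally show ?thesis .
qed

text \<open>The map \<open>c\<close> to \<open>6 - c\<close> permutes the alphabet and preserves
  distances, so the recursion commutes with it.\<close>

lemma completions_reflect: "completions n s (6 - a) = completions n s a"
proof (induction n arbitrary: s a)
  case 0
  then show ?case by (simp add: completions_0)
next
  case (Suc n)
  have "completions (Suc n) s a = (\<Sum>c\<in>{1..5}. if \<bar>a - (6 - c)\<bar> \<le> 1 then completions n True (6 - c)
     else if s then completions n False (6 - c) else 0)"
    unfolding completions_Suc
    by (rule sum.reindex_bij_witness[of _ "\<lambda>c. 6 - c" "\<lambda>c. 6 - c"]) auto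
  also have "\<dots> = completions (Suc n) s (6 - a)"
    unfolding completions_Suc Suc.IH by (intro sum.cong) (auto simp: abs_le_iff)
  finally show ?case by simp
qed

lemma one_to_five: "{1..5::int} = {1, 2, 3, 4, 5}"
  by auto

text \<open>Letters 4 and 5 are identified with 2 and 1; the factors 2 arise where both members of a
  mirror pair contribute.\<close>

lemma completions_reduced:
  "completions (Suc n) True 1 = completions n True 1 + completions n True 2
     + completions n False 1 + completions n False 2 + completions n False 3"
  "completions (Suc n) True 2 = completions n True 1 + completions n True 2 + completions n True 3
     + completions n False 1 + completions n False 2"
  "completions (Suc n) True 3 = 2 * completions n True 2 + completions n True 3
     + 2 * completions n False 1"
  "completions (Suc n) False 1 = completions n True 1 + completions n True 2"
  "completions (Suc n) False 2 = completions n True 1 + completions n True 2 + completions n True 3"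
  "completions (Suc n) False 3 = 2 * completions n True 2 + completions n True 3"
  using completions_reflect[of n _ 1] completions_reflect[of n _ 2]
  by (simp_all add: completions_Suc one_to_five)

lemma b_Suc_reduced:
  "b (Suc n) = 2 * completions n False 1 + 2 * completions n False 2 + completions n False 3"
  using completions_reflect[of n _ 1] completions_reflect[of n _ 2]
  by (simp add: b_Suc one_to_five)

text \<open>An instance of Cayley-Hamilton: the matrix of the reduced system has characteristic
  polynomial \<open>x^6 - 3*x^5 - 4*x^4 - 6*x^2 - 4*x - 4\<close>. Only nonempty words obey the
  system, hence the outer \<open>Suc\<close>.\<close>

lemma b_recurrence_shifted:
  "b (Suc (n + 6)) = 3 * b (Suc (n + 5)) + 4 * b (Suc (n + 4)) + 6 * b (Suc (n + 2))
     + 4 * b (Suc (n + 1)) + 4 * b (Suc n)"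
proof -
  have idx: "n + 6 = Suc (Suc (Suc (Suc (Suc (Suc n)))))" "n + 5 = Suc (Suc (Suc (Suc (Suc n))))"
    "n + 4 = Suc (Suc (Suc (Suc n)))" "n + 2 = Suc (Suc n)" "n + 1 = Suc n"
    by simp_all
  show ?thesis
    unfolding idx b_Suc_reduced
    \<comment> \<open>Six consecutive instances express both sides as linear forms in the six counts
      at length \<open>n\<close>.\<close>
    using completions_reduced[of n]
      completions_reduced[of "Suc n"]
      completions_reduced[of "Suc (Suc n)"]
      completions_reduced[of "Suc (Suc (Suc n))"]
      completions_reduced[of "Suc (Suc (Suc (Suc n)))"]
      completions_reduced[of "Suc (Suc (Suc (Suc (Suc n))))"]
    by algebra
qed

text \<open>The bound is sharp: since \<open>b 0 = 1\<close>, the right side at \<open>n = 6\<close>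
  would be 2711, not 2715. The defect 4 is the top coefficient of the numerator.\<close>

lemma b_recurrence:
  assumes "n > 6"
  shows "b n = 3 * b (n - 1) + 4 * b (n - 2) + 6 * b (n - 4) + 4 * b (n - 5) + 4 * b (n - 6)"
proof -
  obtain m where "n = m + 7"
    using assms by (metis Suc_leI add.commute eval_nat_numeral(3) le_Suc_ex)
  then show ?thesis using b_recurrence_shifted[of m] by (simp add: eval_nat_numeral)
qed

lemma b_initial: "b 1 = 0" "b 2 = 13" "b 3 = 35" "b 4 = 169" "b 5 = 651" "b 6 = 2715"
  by (simp_all add: b_Suc_reduced completions_reduced completions_0 eval_nat_numeral)

lemma mult_denominator_nth:
  fixes F :: "rat fps"
  shows "fps_nth (F * (1 - 3 * fps_X - 4 * fps_X ^ 2 - 6 * fps_X ^ 4 - 4 * fps_X ^ 5 - 4 * fps_X ^ 6)) n =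
    fps_nth F n - 3 * fps_nth (F * fps_X ^ 1) n - 4 * fps_nth (F * fps_X ^ 2) n
      - 6 * fps_nth (F * fps_X ^ 4) n - 4 * fps_nth (F * fps_X ^ 5) n - 4 * fps_nth (F * fps_X ^ 6) n"
proof -
  \<comment> \<open>Writing \<open>fps_X ^ 1\<close> lets one rule for \<open>F * fps_X ^ k\<close>
    later turn every term into an index shift.\<close>
  have "F * (1 - 3 * fps_X - 4 * fps_X ^ 2 - 6 * fps_X ^ 4 - 4 * fps_X ^ 5 - 4 * fps_X ^ 6) =
    F - 3 * (F * fps_X ^ 1) - 4 * (F * fps_X ^ 2)
      - 6 * (F * fps_X ^ 4) - 4 * (F * fps_X ^ 5) - 4 * (F * fps_X ^ 6)"
    by (simp only: right_diff_distrib mult_1_right power_one_right mult.left_commute[of F])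
  then show ?thesis
    by (simp only: numeral_fps_const fps_sub_nth fps_mult_left_const_nth)
qed

lemma numerator_nth:
  "fps_nth (1 - 3 * fps_X + 9 * fps_X ^ 2 - 4 * fps_X ^ 3 + 6 * fps_X ^ 4 + 4 * fps_X ^ 6 :: rat fps) n =
   (if n = 0 then 1 else if n = 1 then -3 else if n = 2 then 9 else if n = 3 then -4
    else if n = 4 then 6 else if n = 6 then 4 else 0)"
  by (simp add: numeral_fps_const)

theorem mainTheorem10:
  shows "(Abs_fps (\<lambda>n. of_nat (b n)) :: rat fps) =
      (1 - 3 * fps_X + 9 * fps_X ^ 2 - 4 * fps_X ^ 3 + 6 * fps_X ^ 4 + 4 * fps_X ^ 6) /
      (1 - 3 * fps_X - 4 * fps_X ^ 2 - 6 * fps_X ^ 4 - 4 * fps_X ^ 5 - 4 * fps_X ^ 6)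
    \<and> (\<forall>n > 6. b n = 3 * b (n - 1) + 4 * b (n - 2) + 6 * b (n - 4)
                     + 4 * b (n - 5) + 4 * b (n - 6))"
    (is "?F = ?N / ?D \<and> _")
proof
  have "?F * ?D = ?N"
  proof (rule fps_ext)
    fix n
    have D: "fps_nth (?F * ?D) n = of_nat (b n) - 3 * (if n < 1 then 0 else of_nat (b (n - 1)))
      - 4 * (if n < 2 then 0 else of_nat (b (n - 2))) - 6 * (if n < 4 then 0 else of_nat (b (n - 4)))
      - 4 * (if n < 5 then 0 else of_nat (b (n - 5))) - 4 * (if n < 6 then 0 else of_nat (b (n - 6)))"
      unfolding mult_denominator_nth fps_X_power_mult_right_nth fps_nth_Abs_fps ..
    \<comment> \<open>Up to degree 6 the numerator is matched by explicit values; beyond it both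
      sides vanish by the recurrence.\<close>
    consider "n = 0" | "n = 1" | "n = 2" | "n = 3" | "n = 4" | "n = 5" | "n = 6" | "n > 6"
      by linarith
    then show "fps_nth (?F * ?D) n = fps_nth ?N n"
    proof cases
      case 8
      then show ?thesis
        unfolding D numerator_nth by (simp add: b_recurrence[OF 8])
    \<comment> \<open>The simplifier rewrites \<open>b 1\<close> to \<open>b (Suc 0)\<close>, so
      this value is supplied in that form too.\<close>
    qed (unfold D numerator_nth, simp_all add: b_0 b_initial b_initial(1)[simplified])
  qed
  \<comment> \<open>The constant term 1 makes \<open>?D\<close> nonzero, which permits cancelling it
    in the quotient.\<close>
  moreover have "fps_nth ?D 0 \<noteq> 0" by simp
  then have "?D \<noteq> 0" by (metis fps_zero_nth)
  ultimately show "?F = ?N / ?D"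
    by (metis nonzero_mult_div_cancel_right)
qed (intro allI impI, rule b_recurrence)

end
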